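(* Let $(X,p)$ and $(Y,d)$ be metric spaces with $(Y,d)$ separable, and let $F: X\Rightarrow Y$ be a (total) multi-valued function whose graph $\{(x,y):y\in F(x)\}$ is a $\Sigma^0_2$ subset of $X\times Y$. (a) If $Y$ is compact and $F(x)$ is closed for every $x\in X$, then the set of points of strong continuity of $F$ is a $\Pi^0_2$ subset of $X$. (b) If $Y$ is exhaustible by compact sets and $F(x)$ is closed for every $x\in X$, then the set of points of strong continuity of $F$ is a $\Sigma^0_3$ subset of $X$.
   Context: A multi-valued function $F: X \Rightarrow Y$ assigns to each $x$ a nonempty subset $F(x)\subseteq Y$. $F$ is strongly continuous at $x$ if for every $y\in F(x)$ and every $\varepsilon>0$ there is $\delta>0$ such that for every $x'$ with $p(x,x')<\delta$ there is $y'\in F(x')$ with $d(y,y')<\varepsilon$. $Y$ is exhaustible by compact sets if there is a sequence $(K_n)_{n\in\omega}$ of compact subsets of $Y$ with each $K_n$ contained in the interior of $K_{n+1}$ and $Y=\bigcup_n K_n$. $\Sigma^0_n,\Pi^0_n$ are the usual levels of the Borel hierarchy ($\Sigma^0_2=F_\sigma$, $\Pi^0_2=G_\delta$, $\Sigma^0_3$ = countable unions of $G_\delta$ sets). *)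

theory Defs
  imports "HOL-Analysis.Analysis"
begin

definition multifunction :: "'a set \<Rightarrow> 'b set \<Rightarrow> ('a \<Rightarrow> 'b set) \<Rightarrow> bool"
  where "multifunction X Y F \<longleftrightarrow> (\<forall>x\<in>X. F x \<noteq> {} \<and> F x \<subseteq> Y)"

definition strongly_continuous_at ::
    "'a set \<Rightarrow> ('a \<Rightarrow> 'a \<Rightarrow> real) \<Rightarrow> ('b \<Rightarrow> 'b \<Rightarrow> real) \<Rightarrow> ('a \<Rightarrow> 'b set) \<Rightarrow> 'a \<Rightarrow> bool"
  where "strongly_continuous_at X p d F x \<longleftrightarrow>
    (\<forall>y\<in>F x. \<forall>\<epsilon>>0. \<exists>\<delta>>0. \<forall>x'\<in>X. p x x' < \<delta> \<longrightarrow> (\<exists>y'\<in>F x'. d y y' < \<epsilon>))"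

definition exhaustible_by_compact_sets :: "'a topology \<Rightarrow> bool"
  where "exhaustible_by_compact_sets T \<longleftrightarrow>
    (\<exists>K :: nat \<Rightarrow> 'a set. (\<forall>n. compactin T (K n)) \<and>
       (\<forall>n. K n \<subseteq> T interior_of K (Suc n)) \<and> (\<Union>n. K n) = topspace T)"

text \<open>The class \<open>\<Sigma>\<^sup>0\<^sub>3\<close>; the classes \<open>\<Sigma>\<^sup>0\<^sub>2\<close> and \<open>\<Pi>\<^sup>0\<^sub>2\<close> are \<^const>\<open>fsigma_in\<close>
  and \<^const>\<open>gdelta_in\<close>.\<close>

definition gdelta_sigma_in :: "'a topology \<Rightarrow> 'a set \<Rightarrow> bool"
  where "gdelta_sigma_in T = countable union_of gdelta_in T"

end

theory Submission
  imports Defs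
begin

text \<open>In both cases \<open>Y\<close> is \<open>\<sigma>\<close>-compact, and this already makes the set \<open>\<Pi>\<^sup>0\<^sub>2\<close>.
  Projections of closed sets along a compact factor are closed, so projections of
  \<open>\<Sigma>\<^sup>0\<^sub>2\<close> sets along a \<open>\<sigma>\<close>-compact factor are \<open>\<Sigma>\<^sup>0\<^sub>2\<close>. Open subsets of \<open>Y\<close> are again
  \<open>\<sigma>\<close>-compact, hence \<open>F\<^sup>-(V) = {x. F x \<inter> V \<noteq> {}}\<close> is \<open>\<Sigma>\<^sup>0\<^sub>2\<close> for \<open>V\<close> open. Strong continuity
  fails at \<open>x\<close> iff \<open>x \<in> F\<^sup>-(V)\<close> but \<open>x\<close> is not interior to \<open>F\<^sup>-(V)\<close>, for some \<open>V\<close> in a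
  countable base, so the points of discontinuity form a \<open>\<Sigma>\<^sup>0\<^sub>2\<close> set.\<close>

text \<open>Projecting away a compact factor is a closed map; the factor here is \<open>K\<close>
  with its subspace topology.\<close>

lemma closedin_fst_image_Int_compactin:
  assumes "closedin (prod_topology S T) C" "compactin T K"
  shows "closedin S (fst ` (C \<inter> topspace S \<times> K))"
proof -
  have "closedin (prod_topology S (subtopology T K)) (C \<inter> topspace S \<times> K)"
    using assms(1) unfolding prod_topology_subtopology(2) closedin_subtopology by blast
  moreover have "compact_space (subtopology T K)"
    using assms(2) by (simp add: compactin_subspace)
  ultimately show ?thesis
    using closed_map_fst closed_map_def by blast
qed

text \<open>Direct images commute with unions. Splitting \<open>G\<close> into countably many closed
  sets and the second factor into the members of \<open>\<K>\<close> therefore leaves only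
  projections of closed sets along a compact set.\<close>

lemma fsigma_in_fst_image_Int_sigma_compact:
  assumes "fsigma_in (prod_topology S T) G"
    and "countable \<K>" "\<And>K. K \<in> \<K> \<Longrightarrow> compactin T K"
  shows "fsigma_in S (fst ` (G \<inter> topspace S \<times> \<Union>\<K>))"
proof -
  obtain C :: "nat \<Rightarrow> _" where C: "\<And>n. closedin (prod_topology S T) (C n)" "\<Union>(range C) = G"
    using assms(1) by (auto simp: fsigma_in_ascending)
  have "fsigma_in S (fst ` (C n \<inter> topspace S \<times> K))" if "K \<in> \<K>" for n K
    using closedin_fst_image_Int_compactin[OF C(1) assms(3)[OF that]] by (rule closed_imp_fsigma_in)
  then have "fsigma_in S (\<Union>K\<in>\<K>. fst ` (C n \<inter> topspace S \<times> K))" for n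
    by (intro fsigma_in_Union countable_image[OF assms(2)]) blast
  then have "fsigma_in S (\<Union>n. \<Union>K\<in>\<K>. fst ` (C n \<inter> topspace S \<times> K))"
    by (intro fsigma_in_Union) auto
  also have "(\<Union>n. \<Union>K\<in>\<K>. fst ` (C n \<inter> topspace S \<times> K)) = fst ` (G \<inter> topspace S \<times> \<Union>\<K>)"
    unfolding C(2)[symmetric] by blast
  finally show ?thesis .
qed

text \<open>In a metrizable space \<open>V\<close> is a countable union of closed sets, and a closed
  set meets a compact set in a compact set.\<close>

lemma openin_sigma_compact:
  assumes "metrizable_space T" "openin T V"
    and "countable \<K>" "\<And>K. K \<in> \<K> \<Longrightarrow> compactin T K" "\<Union>\<K> = topspace T"
  obtains \<L> where "countable \<L>" "\<And>L. L \<in> \<L> \<Longrightarrow> compactin T L" "\<Union>\<L> = V"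
proof -
  obtain D :: "nat \<Rightarrow> _" where D: "\<And>n. closedin T (D n)" "\<Union>(range D) = V"
    using open_imp_fsigma_in[OF assms(1,2)] by (auto simp: fsigma_in_ascending)
  show thesis
  proof
    let ?\<L> = "(\<lambda>(n, K). D n \<inter> K) ` (UNIV \<times> \<K>)"
    show "countable ?\<L>"
      using assms(3) by simp
    show "compactin T L" if "L \<in> ?\<L>" for L
      using that D(1) assms(4) by (auto intro: closed_Int_compactin)
    have "V \<subseteq> \<Union>\<K>"
      using assms(2,5) by (simp add: openin_subset)
    then show "\<Union>?\<L> = V"
      unfolding D(2)[symmetric] by (simp add: UN_Times_distrib) blast
  qed
qed

text \<open>The base consists of the balls of radius \<open>1 / real (Suc n)\<close> centred at the
  points of a countable dense set.\<close>

lemma (in Metric_space) separable_imp_second_countable: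
  assumes "separable_space mtopology"
  shows "second_countable mtopology"
proof -
  obtain S where S: "countable S" "S \<subseteq> M" "mtopology closure_of S = M"
    using assms by (auto simp: separable_space_def)
  define \<B> where "\<B> = (\<Union>s\<in>S. range (\<lambda>n. mball s (1 / real (Suc n))))"
  have "\<exists>B\<in>\<B>. y \<in> B \<and> B \<subseteq> U" if U: "openin mtopology U" "y \<in> U" for U y
  proof -
    obtain r where "r > 0" and r: "mball y r \<subseteq> U"
      using U by (auto simp: openin_mtopology)
    \<comment> \<open>Half of \<open>r\<close> covers the distance from \<open>y\<close> to a dense
      point \<open>s\<close>, the other half the radius of the ball around \<open>s\<close>.\<close>
    then obtain n where n: "1 / real (Suc n) < r / 2"
      using nat_approx_posE[of "r / 2"] by auto
    have "y \<in> M"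
      using U by (auto simp: openin_mtopology)
    then have "y \<in> mtopology closure_of S"
      using S(3) by simp
    then have "\<exists>s\<in>S. s \<in> mball y (1 / real (Suc n))"
      unfolding metric_closure_of by (auto simp del: of_nat_Suc)
    then obtain s where s: "s \<in> S" "s \<in> mball y (1 / real (Suc n))"
      by blast
    have "mball s (1 / real (Suc n)) \<subseteq> mball y r"
    proof
      fix z assume "z \<in> mball s (1 / real (Suc n))"
      then show "z \<in> mball y r"
        using s(2) n triangle[of y s z] by simp
    qed
    moreover have "y \<in> mball s (1 / real (Suc n))"
      using s(2) by (simp add: commute)
    moreover have "mball s (1 / real (Suc n)) \<in> \<B>"
      using s(1) unfolding \<B>_def by blast
    ultimately show ?thesis
      using r by blast
  qed
  moreover have "countable \<B>"
    unfolding \<B>_def using S(1) by (intro countable_UN) simp_all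
  moreover have "\<forall>B\<in>\<B>. openin mtopology B"
    unfolding \<B>_def by blast
  ultimately show ?thesis
    unfolding second_countable_def by blast
qed

text \<open>Every member of \<open>\<B>\<close> containing \<open>y\<close> contains a ball around
  \<open>y\<close>, and every such ball contains a member of \<open>\<B>\<close> through
  \<open>y\<close>. For countable \<open>\<B>\<close> this replaces the quantifiers over
  \<open>y\<close> and \<open>\<epsilon>\<close> by a countable one.\<close>

lemma strongly_continuous_at_iff_base:
  fixes X :: "'a set" and Y :: "'b set"
  assumes "Metric_space X p" "Metric_space Y d" "multifunction X Y F" "x \<in> X"
    and "\<And>B. B \<in> \<B> \<Longrightarrow> openin (Metric_space.mtopology Y d) B"
    and "\<And>U y. openin (Metric_space.mtopology Y d) U \<Longrightarrow> y \<in> U \<Longrightarrow> \<exists>B\<in>\<B>. y \<in> B \<and> B \<subseteq> U"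
  shows "strongly_continuous_at X p d F x \<longleftrightarrow>
    (\<forall>B\<in>\<B>. F x \<inter> B \<noteq> {} \<longrightarrow>
       x \<in> Metric_space.mtopology X p interior_of {x\<in>X. F x \<inter> B \<noteq> {}})"
proof -
  interpret X: Metric_space X p by fact
  interpret Y: Metric_space Y d by fact
  have F: "\<And>x y. x \<in> X \<Longrightarrow> y \<in> F x \<Longrightarrow> y \<in> Y"
    using assms(3) by (auto simp: multifunction_def)
  show ?thesis
  proof (intro iffI ballI impI)
    fix B assume cont: "strongly_continuous_at X p d F x" and B: "B \<in> \<B>" "F x \<inter> B \<noteq> {}"
    then obtain y where y: "y \<in> F x" "y \<in> B"
      by blast
    then obtain r where r: "r > 0" "Y.mball y r \<subseteq> B"
      using assms(5)[OF B(1)] unfolding Y.openin_mtopology by blast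
    then obtain \<delta> where \<delta>: "\<delta> > 0" "\<forall>x'\<in>X. p x x' < \<delta> \<longrightarrow> (\<exists>y'\<in>F x'. d y y' < r)"
      using cont y(1) unfolding strongly_continuous_at_def by blast
    have "X.mball x \<delta> \<subseteq> {x\<in>X. F x \<inter> B \<noteq> {}}"
    proof
      fix x' assume x': "x' \<in> X.mball x \<delta>"
      then obtain y' where "y' \<in> F x'" "d y y' < r"
        using \<delta>(2) by auto
      \<comment> \<open>Membership in \<open>Y.mball y r\<close> also requires \<open>y\<close> and
        \<open>y'\<close> to lie in \<open>Y\<close>, hence the appeal to \<open>F\<close>.\<close>
      then have "y' \<in> B"
        using r(2) x' y(1) F assms(4) by (auto simp: subset_iff)
      then show "x' \<in> {x\<in>X. F x \<inter> B \<noteq> {}}"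
        using \<open>y' \<in> F x'\<close> x' by auto
    qed
    then show "x \<in> X.mtopology interior_of {x\<in>X. F x \<inter> B \<noteq> {}}"
      using \<open>\<delta> > 0\<close> assms(4) by (auto simp: X.metric_interior_of)
  next
    assume *: "\<forall>B\<in>\<B>. F x \<inter> B \<noteq> {} \<longrightarrow>
      x \<in> X.mtopology interior_of {x\<in>X. F x \<inter> B \<noteq> {}}"
    show "strongly_continuous_at X p d F x"
      unfolding strongly_continuous_at_def
    proof (intro ballI allI impI)
      fix y and \<epsilon> :: real
      assume y: "y \<in> F x" and "\<epsilon> > 0"
      then obtain B where B: "B \<in> \<B>" "y \<in> B" "B \<subseteq> Y.mball y \<epsilon>"
        using assms(6)[of "Y.mball y \<epsilon>" y] F[OF assms(4)] by auto
      then obtain \<delta> where "\<delta> > 0" "X.mball x \<delta> \<subseteq> {x\<in>X. F x \<inter> B \<noteq> {}}"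
        using * y by (auto simp: X.metric_interior_of)
      then show "\<exists>\<delta>>0. \<forall>x'\<in>X. p x x' < \<delta> \<longrightarrow> (\<exists>y'\<in>F x'. d y y' < \<epsilon>)"
        using B(3) assms(4) by (intro exI[of _ \<delta>]) (fastforce simp: subset_iff)
    qed
  qed
qed

text \<open>Common source of both parts: compactness and exhaustibility each provide a countable
  compact cover \<open>\<K>\<close> of the space.\<close>

lemma gdelta_in_strongly_continuous_at:
  fixes X :: "'a set" and p :: "'a \<Rightarrow> 'a \<Rightarrow> real"
    and Y :: "'b set" and d :: "'b \<Rightarrow> 'b \<Rightarrow> real"
  defines "TX \<equiv> Metric_space.mtopology X p"
    and "TY \<equiv> Metric_space.mtopology Y d"
  assumes "Metric_space X p" "Metric_space Y d" "separable_space TY" "multifunction X Y F"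
    and graph: "fsigma_in (prod_topology TX TY) {(x, y). x \<in> X \<and> y \<in> F x}"
    and \<K>: "countable \<K>" "\<And>K. K \<in> \<K> \<Longrightarrow> compactin TY K" "\<Union>\<K> = topspace TY"
  shows "gdelta_in TX {x \<in> X. strongly_continuous_at X p d F x}"
proof -
  interpret X: Metric_space X p by fact
  interpret Y: Metric_space Y d by fact
  have [simp]: "topspace TX = X"
    by (simp add: TX_def)
  obtain \<B> where \<B>: "countable \<B>" "\<And>B. B \<in> \<B> \<Longrightarrow> openin TY B"
      "\<And>U y. openin TY U \<Longrightarrow> y \<in> U \<Longrightarrow> \<exists>B\<in>\<B>. y \<in> B \<and> B \<subseteq> U"
    using Y.separable_imp_second_countable assms(5) unfolding TY_def second_countable_def by metis
  define P where "P B = {x\<in>X. F x \<inter> B \<noteq> {}}" for B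
  have "fsigma_in TX (P B)" if B: "B \<in> \<B>" for B
  proof -
    obtain \<L> where \<L>: "countable \<L>" "\<And>L. L \<in> \<L> \<Longrightarrow> compactin TY L" "\<Union>\<L> = B"
      using openin_sigma_compact[of TY B \<K>] \<B>(2)[OF B] \<K> Y.metrizable_space_mtopology
      unfolding TY_def by metis
    \<comment> \<open>\<open>P B\<close> is the projection of the part of the graph lying over
      \<open>B\<close>, and \<open>B\<close> is now sigma-compact.\<close>
    have "P B = fst ` ({(x, y). x \<in> X \<and> y \<in> F x} \<inter> topspace TX \<times> \<Union>\<L>)"
      unfolding \<L>(3) P_def fst_eq_Domain Domain_unfold by auto
    then show ?thesis
      using fsigma_in_fst_image_Int_sigma_compact[OF graph \<L>(1,2)] by simp
  qed
  \<comment> \<open>The interior is open, hence G-delta, and an F-sigma set minus a G-delta set is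
    F-sigma.\<close>
  then have "fsigma_in TX (\<Union>B\<in>\<B>. P B - TX interior_of P B)"
    using \<B>(1) by (intro fsigma_in_Union) (auto intro!: fsigma_in_diff open_imp_gdelta_in)
  then have "gdelta_in TX (topspace TX - (\<Union>B\<in>\<B>. P B - TX interior_of P B))"
    by (rule gdelta_in_diff[OF gdelta_in_topspace])
  also have "topspace TX - (\<Union>B\<in>\<B>. P B - TX interior_of P B) =
      {x \<in> X. strongly_continuous_at X p d F x}"
  proof -
    have "strongly_continuous_at X p d F x \<longleftrightarrow> x \<notin> (\<Union>B\<in>\<B>. P B - TX interior_of P B)"
      if "x \<in> X" for x
    proof -
      have "strongly_continuous_at X p d F x \<longleftrightarrow>
          (\<forall>B\<in>\<B>. F x \<inter> B \<noteq> {} \<longrightarrow> x \<in> TX interior_of P B)"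
        unfolding P_def TX_def
        by (rule strongly_continuous_at_iff_base[OF assms(3,4,6) that \<B>(2,3)[unfolded TY_def]])
      moreover have "F x \<inter> B \<noteq> {} \<longleftrightarrow> x \<in> P B" for B
        using that by (simp add: P_def)
      ultimately show ?thesis
        by blast
    qed
    then show ?thesis
      unfolding \<open>topspace TX = X\<close> by blast
  qed
  finally show ?thesis .
qed

theorem theorem3p2:
  fixes X :: "'a set" and p :: "'a \<Rightarrow> 'a \<Rightarrow> real"
    and Y :: "'b set" and d :: "'b \<Rightarrow> 'b \<Rightarrow> real"
    and F :: "'a \<Rightarrow> 'b set"
  defines "TX \<equiv> Metric_space.mtopology X p"
    and "TY \<equiv> Metric_space.mtopology Y d"
  assumes "Metric_space X p" and "Metric_space Y d"
    and "separable_space TY"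
    and "multifunction X Y F"
    and "fsigma_in (prod_topology TX TY) {(x, y). x \<in> X \<and> y \<in> F x}"
  shows "(compact_space TY \<and> (\<forall>x\<in>X. closedin TY (F x)) \<longrightarrow>
            gdelta_in TX {x \<in> X. strongly_continuous_at X p d F x}) \<and>
         (exhaustible_by_compact_sets TY \<and> (\<forall>x\<in>X. closedin TY (F x)) \<longrightarrow>
            gdelta_sigma_in TX {x \<in> X. strongly_continuous_at X p d F x})"
proof (intro conjI impI; elim conjE)
  note * = gdelta_in_strongly_continuous_at[OF assms(3-7)[unfolded TX_def TY_def],
      folded TX_def TY_def]
  show "gdelta_in TX {x \<in> X. strongly_continuous_at X p d F x}" if "compact_space TY"
    using *[of "{topspace TY}"] that by (simp add: compact_space_def)
  show "gdelta_sigma_in TX {x \<in> X. strongly_continuous_at X p d F x}"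
    if "exhaustible_by_compact_sets TY"
  proof -
    obtain K :: "nat \<Rightarrow> 'b set" where "\<forall>n. compactin TY (K n)" "(\<Union>n. K n) = topspace TY"
      using \<open>exhaustible_by_compact_sets TY\<close> by (auto simp: exhaustible_by_compact_sets_def)
    then have "gdelta_in TX {x \<in> X. strongly_continuous_at X p d F x}"
      using *[of "range K"] by auto
    \<comment> \<open>A G-delta set is a countable union of G-delta sets with a single
      member.\<close>
    then show ?thesis
      by (simp add: gdelta_sigma_in_def countable_union_of_inc)
  qed
qed

end
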